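(* Let $X\in\mathbb{R}^{n\times d}$, $y\in\mathbb{R}^n$, $\beta>0$, $m_1\ge1$. For $K\ge1$ let $$P^*=\min_{\{W_{1k},w_{2k},w_{3k}\}_{k=1}^K:\ \|W_{1k}\|_F\le 1\ \forall k}\ \frac12\Big\|\sum_{k=1}^K\big((XW_{1k})_+w_{2k}\big)_+w_{3k}-y\Big\|_2^2+\frac{\beta}{2}\sum_{k=1}^K\big(\|w_{2k}\|_2^2+w_{3k}^2\big),$$ where $W_{1k}\in\mathbb{R}^{d\times m_1}$, $w_{2k}\in\mathbb{R}^{m_1}$, $w_{3k}\in\mathbb{R}$. Let $\Theta_p=\{(W_1,w_2)\in\mathbb{R}^{d\times m_1}\times\mathbb{R}^{m_1}:\|W_1\|_F\le1,\ \|w_2\|_2\le1\}$ and define $$D^*=\max_{v\in\mathbb{R}^n}\ -\frac12\|v-y\|_2^2+\frac12\|y\|_2^2\quad\text{s.t.}\quad \max_{(W_1,w_2)\in\Theta_p}\big|v^T\big((XW_1)_+w_2\big)_+\big|\le\beta,$$ $$P_B^*=\min_{\mu}\ \frac12\Big\|\int_{\Theta_p}\big((XW_1)_+w_2\big)_+\,d\mu(W_1,w_2)-y\Big\|_2^2+\beta\|\mu\|_{TV},$$ where $\mu$ ranges over signed Radon measures on $\Theta_p$. Then there is an integer $K^*\le n+1$ such that, whenever $K\ge K^*$, strong duality holds: $P^*=P_B^*=D^*$.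
   Context: $(\cdot)_+=\max\{\cdot,0\}$ is applied elementwise; $\|\cdot\|_F$ is the Frobenius norm; $\|\mu\|_{TV}$ is the total variation norm of the signed Radon measure $\mu$. *)

theory Defs
  imports "HOL-Analysis.Analysis"
begin

section \<open>Signed Radon measures\<close>

text \<open>A signed measure on \<open>M\<close> is a real-valued, countably additive set function on \<open>sets M\<close>; only
  the sigma-algebra of \<open>M\<close> is used, and values of \<open>\<mu>\<close> off \<open>sets M\<close> play no role.\<close>

definition signed_measure :: "'a measure \<Rightarrow> ('a set \<Rightarrow> real) \<Rightarrow> bool" where
  "signed_measure M \<mu> \<longleftrightarrow>
     \<mu> {} = 0 \<and>
     (\<forall>A :: nat \<Rightarrow> 'a set. range A \<subseteq> sets M \<longrightarrow> disjoint_family A \<longrightarrow>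
        (\<lambda>i. \<mu> (A i)) sums \<mu> (\<Union>i. A i))"

text \<open>The total variation \<open>\<bar>\<mu>\<bar>(E)\<close>: supremum over countable measurable partitions of \<open>E\<close>.\<close>

definition variation :: "'a measure \<Rightarrow> ('a set \<Rightarrow> real) \<Rightarrow> 'a set \<Rightarrow> ennreal" where
  "variation M \<mu> E =
     (SUP A \<in> {A :: nat \<Rightarrow> 'a set. range A \<subseteq> sets M \<and> disjoint_family A \<and> (\<Union>i. A i) = E}.
        \<Sum>i. ennreal \<bar>\<mu> (A i)\<bar>)"

text \<open>The Jordan decomposition \<open>\<mu>\<^sup>+ = (\<bar>\<mu>\<bar> + \<mu>) / 2\<close>, \<open>\<mu>\<^sup>- = (\<bar>\<mu>\<bar> - \<mu>) / 2\<close>.\<close>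

definition pos_part :: "'a measure \<Rightarrow> ('a set \<Rightarrow> real) \<Rightarrow> 'a measure" where
  "pos_part M \<mu> =
     measure_of (space M) (sets M) (\<lambda>E. ennreal ((enn2real (variation M \<mu> E) + \<mu> E) / 2))"

definition neg_part :: "'a measure \<Rightarrow> ('a set \<Rightarrow> real) \<Rightarrow> 'a measure" where
  "neg_part M \<mu> =
     measure_of (space M) (sets M) (\<lambda>E. ennreal ((enn2real (variation M \<mu> E) - \<mu> E) / 2))"

definition signed_integral ::
  "'a measure \<Rightarrow> ('a set \<Rightarrow> real) \<Rightarrow> ('a \<Rightarrow> 'b::{banach, second_countable_topology}) \<Rightarrow> 'b" where
  "signed_integral M \<mu> f = (LINT x|pos_part M \<mu>. f x) - (LINT x|neg_part M \<mu>. f x)"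

text \<open>\<open>\<mu>\<close> is a signed Radon measure on \<open>T\<close> if \<open>\<bar>\<mu>\<bar>\<close> is finite on compact sets and inner
  regular.\<close>

definition signed_radon_measure :: "'a::topological_space set \<Rightarrow> ('a set \<Rightarrow> real) \<Rightarrow> bool" where
  "signed_radon_measure T \<mu> \<longleftrightarrow>
     (let M = restrict_space borel T in
        signed_measure M \<mu> \<and>
        (\<forall>C \<in> sets M. compact C \<longrightarrow> variation M \<mu> C < \<infinity>) \<and>
        (\<forall>E \<in> sets M. variation M \<mu> E =
           (SUP C \<in> {C \<in> sets M. compact C \<and> C \<subseteq> E}. variation M \<mu> C)))"

text \<open>For a signed Radon measure on a compact \<open>T\<close> the variation of \<open>T\<close> is finite, so \<open>enn2real\<close>
  loses nothing.\<close>

definition tv_norm :: "'a::topological_space set \<Rightarrow> ('a set \<Rightarrow> real) \<Rightarrow> real" where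
  "tv_norm T \<mu> = enn2real (variation (restrict_space borel T) \<mu> T)"


section \<open>Parallel three-layer ReLU networks\<close>

definition relu_vec :: "real^'a \<Rightarrow> real^'a" where
  "relu_vec v = (\<chi> i. max (v $ i) 0)"

definition relu_mat :: "real^'a^'b \<Rightarrow> real^'a^'b" where
  "relu_mat A = (\<chi> i j. max (A $ i $ j) 0)"

definition subnet :: "real^'d^'n \<Rightarrow> (real^'m^'d) \<times> (real^'m) \<Rightarrow> real^'n" where
  "subnet X = (\<lambda>(W1, w2). relu_vec (relu_mat (X ** W1) *v w2))"

text \<open>The library norm on matrices is the Frobenius norm.\<close>

lemma norm_matrix_Frobenius:
  fixes A :: "real^'a^'b"
  shows "norm A = sqrt (\<Sum>i\<in>UNIV. \<Sum>j\<in>UNIV. (A $ i $ j)\<^sup>2)"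
  by (simp add: norm_vec_def L2_set_def sum_nonneg)

definition Theta_p :: "((real^'m^'d) \<times> (real^'m)) set" where
  "Theta_p = {(W1, w2). norm W1 \<le> 1 \<and> norm w2 \<le> 1}"


section \<open>The three optimization problems\<close>

text \<open>Each problem is given by the set of objective values at feasible points. The objectives of
  the two minimization problems are nonnegative and that of the dual is at most \<open>(norm y)\<^sup>2 / 2\<close>,
  so \<open>Inf\<close> and \<open>Sup\<close> below are genuine; that they are a minimum and a maximum is membership in
  the set of values. The \<open>itself\<close> argument carries the inner width \<open>CARD('m)\<close>, which does not
  occur in the types of the data.\<close>

definition primal_values ::
  "'m::finite itself \<Rightarrow> real^'d^'n \<Rightarrow> real^'n \<Rightarrow> real \<Rightarrow> nat \<Rightarrow> real set" where
  "primal_values TYPE('m) X y \<beta> K =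
     {1/2 * (norm ((\<Sum>k=1..K. w3 k *\<^sub>R relu_vec (relu_mat (X ** W1 k) *v w2 k)) - y))\<^sup>2
        + \<beta>/2 * (\<Sum>k=1..K. (norm (w2 k))\<^sup>2 + (w3 k)\<^sup>2)
      | (W1 :: nat \<Rightarrow> real^'m^'d) (w2 :: nat \<Rightarrow> real^'m) (w3 :: nat \<Rightarrow> real).
        \<forall>k\<in>{1..K}. norm (W1 k) \<le> 1}"

definition bidual_values ::
  "'m::finite itself \<Rightarrow> real^'d^'n \<Rightarrow> real^'n \<Rightarrow> real \<Rightarrow> real set" where
  "bidual_values TYPE('m) X y \<beta> =
     {1/2 * (norm (signed_integral (restrict_space borel Theta_p) \<mu> (subnet X) - y))\<^sup>2
        + \<beta> * tv_norm Theta_p \<mu>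
      | (\<mu> :: ((real^'m^'d) \<times> (real^'m)) set \<Rightarrow> real). signed_radon_measure Theta_p \<mu>}"

text \<open>The \<open>SUP\<close> is a maximum of a continuous function over a nonempty compact set.\<close>

definition dual_values ::
  "'m::finite itself \<Rightarrow> real^'d^'n \<Rightarrow> real^'n \<Rightarrow> real \<Rightarrow> real set" where
  "dual_values TYPE('m) X y \<beta> =
     {- 1/2 * (norm (v - y))\<^sup>2 + 1/2 * (norm y)\<^sup>2
      | v :: real^'n.
        (SUP \<theta> \<in> (Theta_p :: ((real^'m^'d) \<times> (real^'m)) set). \<bar>v \<bullet> subnet X \<theta>\<bar>) \<le> \<beta>}"

definition P_star ::
  "'m::finite itself \<Rightarrow> real^'d^'n \<Rightarrow> real^'n \<Rightarrow> real \<Rightarrow> nat \<Rightarrow> real" where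
  "P_star m X y \<beta> K = Inf (primal_values m X y \<beta> K)"

definition P_B_star ::
  "'m::finite itself \<Rightarrow> real^'d^'n \<Rightarrow> real^'n \<Rightarrow> real \<Rightarrow> real" where
  "P_B_star m X y \<beta> = Inf (bidual_values m X y \<beta>)"

definition D_star ::
  "'m::finite itself \<Rightarrow> real^'d^'n \<Rightarrow> real^'n \<Rightarrow> real \<Rightarrow> real" where
  "D_star m X y \<beta> = Sup (dual_values m X y \<beta>)"

end

(* Let C be the convex hull of the outputs of all subnetworks and their negatives. Minimizing
   |t z - y|^2 / 2 + beta t over t >= 0 and z in C is a finite-dimensional convex problem, and at a
   minimizer the residual v = y - t z is dual feasible with v . (t z) = beta t, so the value equals
   the dual objective at v. By Caratheodory z is a combination of n + 1 outputs; positive homogeneity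
   of the ReLU turns it into a network, and point masses turn it into a measure. Weak duality for
   both problems then forces all optimal values to coincide. *)

theory Submission
  imports Defs
begin

section \<open>Total variation of signed measures\<close>

text \<open>The hull contains negatives because output weights and measures are signed: its points
  are sums of \<open>c k *\<^sub>R f (\<theta> k)\<close> with the \<open>\<bar>c k\<bar>\<close>
  adding up to at most 1, so \<open>t\<close> can stand for a total variation. For a network it
  stands for half the sum of the squared weights: 2ab <= a^2 + b^2 bounds the cost of a unit from
  below, with equality when a weight c is split as sqrt |c| over the two outer layers. The objective
  need not be convex in the pair (t, z), only in (t, t z), which ranges over the convex cone on C.
  The optimality conditions therefore come from two perturbations of t z: adding a little of some s
  in C gives dual feasibility, and shrinking t gives beta t <= v . (t z). All compactness takes
  place in R^n, where Caratheodory supplies the number n + 1. The certificate v is fixed before K,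
  so a single dual value serves all K >= n + 1. Attainment of the primal minimum is claimed for
  smaller K as well, where no duality is available; it follows from coercivity of the weight
  decay.\<close>

lemma variation_ge_abs:
  assumes "signed_measure M \<mu>" "E \<in> sets M"
  shows "ennreal \<bar>\<mu> E\<bar> \<le> variation M \<mu> E"
proof -
  define A where "A = (\<lambda>i::nat. if i = 0 then E else {})"
  have "range A \<subseteq> sets M" "disjoint_family A" "(\<Union>i. A i) = E"
    using assms by (auto simp: A_def disjoint_family_on_def split: if_splits)
  then have "(\<Sum>i. ennreal \<bar>\<mu> (A i)\<bar>) \<le> variation M \<mu> E"
    unfolding variation_def by (intro SUP_upper) auto
  moreover have "ennreal \<bar>\<mu> (A 0)\<bar> \<le> (\<Sum>i. ennreal \<bar>\<mu> (A i)\<bar>)"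
  proof -
    have "(\<Sum>i<1. ennreal \<bar>\<mu> (A i)\<bar>) \<le> (\<Sum>i. ennreal \<bar>\<mu> (A i)\<bar>)"
      by (intro sum_le_suminf) auto
    then show ?thesis by simp
  qed
  ultimately show ?thesis by (simp add: A_def)
qed

text \<open>When \<open>\<nu>\<close> is not a measure on \<open>M\<close>,
  \<open>measure_of\<close> yields the null measure, so for arbitrary \<open>\<nu>\<close> an
  inequality is what can be said.\<close>

lemma emeasure_measure_of_le:
  assumes "E \<in> sets M"
  shows "emeasure (measure_of (space M) (sets M) \<nu>) E \<le> \<nu> E"
  using assms by (simp add: emeasure_measure_of_conv sets.sigma_sets_eq)

text \<open>The two bounds have different jobs: \<open>B\<close> gives integrability of
  \<open>f\<close>, while \<open>\<beta>\<close> bounds the scalar integrand and appears in the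
  result. The total mass is at most \<open>\<nu> (space M)\<close>.\<close>

lemma integral_bounded_measure_of:
  fixes f :: "'a \<Rightarrow> 'b::euclidean_space" and \<nu> :: "'a set \<Rightarrow> real"
  defines "N \<equiv> \<lambda>M. measure_of (space M) (sets M) (\<lambda>E. ennreal (\<nu> E))"
  assumes f: "f \<in> borel_measurable M"
    and B: "\<And>x. x \<in> space M \<Longrightarrow> norm (f x) \<le> B"
    and v: "\<And>x. x \<in> space M \<Longrightarrow> \<bar>v \<bullet> f x\<bar> \<le> \<beta>"
    and "0 \<le> \<beta>" "0 \<le> \<nu> (space M)"
  shows "\<bar>v \<bullet> (LINT x|N M. f x)\<bar> \<le> \<beta> * \<nu> (space M)"
proof -
  have sp: "space (N M) = space M" and st[measurable_cong]: "sets (N M) = sets M"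
    by (simp_all add: N_def)
  have le: "emeasure (N M) (space M) \<le> ennreal (\<nu> (space M))"
    unfolding N_def by (rule emeasure_measure_of_le) simp
  then interpret finite_measure "N M"
    by (intro finite_measureI) (auto simp: sp top_unique)
  have m: "measure (N M) (space M) \<le> \<nu> (space M)"
    using le \<open>0 \<le> \<nu> (space M)\<close> by (simp add: emeasure_eq_measure)
  have fm: "f \<in> borel_measurable (N M)" using f by measurable
  have int: "integrable (N M) f"
    by (rule integrable_const_bound[where B = B]) (auto simp: sp B fm)
  have intv: "integrable (N M) (\<lambda>x. v \<bullet> f x)"
    using int by (intro integrable_inner_right)
  have "\<bar>v \<bullet> (LINT x|N M. f x)\<bar> = \<bar>LINT x|N M. v \<bullet> f x\<bar>"
    using int by simp
  also have "\<dots> \<le> (LINT x|N M. \<bar>v \<bullet> f x\<bar>)"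
    using integral_norm_bound[of "N M" "\<lambda>x. v \<bullet> f x"] by simp
  also have "\<dots> \<le> (LINT x|N M. \<beta>)"
    using intv v by (intro integral_mono) (auto simp: sp)
  also have "\<dots> = \<beta> * measure (N M) (space M)" by (simp add: sp)
  also have "\<dots> \<le> \<beta> * \<nu> (space M)" using m \<open>0 \<le> \<beta>\<close> by (rule mult_left_mono)
  finally show ?thesis .
qed

text \<open>The Jordan decomposition theorem is avoided: \<^const>\<open>measure_of\<close> returns either the intended
  set function or the null measure, and the bound holds in both cases.\<close>

lemma inner_signed_integral_le:
  fixes f :: "'a::t2_space \<Rightarrow> 'b::euclidean_space"
  assumes T: "compact T" and f: "continuous_on T f"
    and v: "\<And>x. x \<in> T \<Longrightarrow> \<bar>v \<bullet> f x\<bar> \<le> \<beta>" and "0 \<le> \<beta>"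
    and \<mu>: "signed_radon_measure T \<mu>"
  shows "v \<bullet> signed_integral (restrict_space borel T) \<mu> f \<le> \<beta> * tv_norm T \<mu>"
proof -
  define M where "M = restrict_space borel T"
  have TM: "T \<in> sets M" and sp: "space M = T"
    using T by (auto simp: M_def sets_restrict_space_iff compact_imp_closed space_restrict_space)
  have sm: "signed_measure M \<mu>" and fin: "variation M \<mu> T < \<infinity>"
    using \<mu> TM T by (auto simp: signed_radon_measure_def M_def Let_def)
  define V where "V = tv_norm T \<mu>"
  have V: "V = enn2real (variation M \<mu> T)" by (simp add: V_def tv_norm_def M_def)
  \<comment> \<open>This makes both masses \<open>(V + \<mu> T) / 2\<close> and
    \<open>(V - \<mu> T) / 2\<close> nonnegative, as \<open>bound\<close> requires.\<close>
  have "ennreal \<bar>\<mu> T\<bar> \<le> ennreal V"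
    using variation_ge_abs[OF sm TM] fin by (simp add: V)
  then have "\<bar>\<mu> T\<bar> \<le> V" by (subst (asm) ennreal_le_iff) (auto simp: V)
  have meas: "f \<in> borel_measurable M"
    unfolding M_def using f by (rule borel_measurable_continuous_on_restrict)
  obtain B where B: "\<And>x. x \<in> T \<Longrightarrow> norm (f x) \<le> B"
    using compact_imp_bounded[OF compact_continuous_image[OF f T]] by (auto simp: bounded_iff)
  note bound = integral_bounded_measure_of[OF meas, of B v \<beta>]
  have "\<bar>v \<bullet> (LINT x|pos_part M \<mu>. f x)\<bar> \<le> \<beta> * ((V + \<mu> T) / 2)"
    unfolding pos_part_def
    using bound[of "\<lambda>E. (enn2real (variation M \<mu> E) + \<mu> E) / 2"] \<open>\<bar>\<mu> T\<bar> \<le> V\<close> B v \<open>0 \<le> \<beta>\<close>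
    by (simp add: sp V)
  moreover have "\<bar>v \<bullet> (LINT x|neg_part M \<mu>. f x)\<bar> \<le> \<beta> * ((V - \<mu> T) / 2)"
    unfolding neg_part_def
    using bound[of "\<lambda>E. (enn2real (variation M \<mu> E) - \<mu> E) / 2"] \<open>\<bar>\<mu> T\<bar> \<le> V\<close> B v \<open>0 \<le> \<beta>\<close>
    by (simp add: sp V)
  ultimately have "v \<bullet> signed_integral M \<mu> f \<le> \<beta> * ((V + \<mu> T) / 2) + \<beta> * ((V - \<mu> T) / 2)"
    by (simp add: signed_integral_def inner_diff_right)
  also have "\<dots> = \<beta> * V" by (simp add: field_simps)
  finally show ?thesis by (simp add: M_def V_def)
qed


section \<open>Finitely supported signed measures\<close>

definition atomic :: "'a set \<Rightarrow> ('a \<Rightarrow> real) \<Rightarrow> 'a set \<Rightarrow> real" where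
  "atomic F a E = (\<Sum>x\<in>F \<inter> E. a x)"

lemma atomic_sums:
  assumes "finite F" "disjoint_family A"
  shows "(\<lambda>i::nat. atomic F a (A i)) sums atomic F a (\<Union>i. A i)"
proof -
  \<comment> \<open>A point lies in at most one \<open>A i\<close>, so this series has at most one
    nonzero term; the finite sum over \<open>F\<close> is then exchanged with the series.\<close>
  have ind: "(\<lambda>i. indicator (A i) x :: real) sums indicator (\<Union>i. A i) x" for x
  proof (cases "x \<in> (\<Union>i. A i)")
    case True
    then obtain j where j: "x \<in> A j" by auto
    have "(\<lambda>i. indicator (A i) x :: real) = (\<lambda>i. if i = j then 1 else 0)"
      using assms(2) j by (fastforce simp: disjoint_family_on_def indicator_def fun_eq_iff)
    then show ?thesis using sums_single[of j "\<lambda>_. 1 :: real"] True by simp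
  qed (auto simp: indicator_def)
  have eq: "atomic F a E = (\<Sum>x\<in>F. a x * indicator E x)" for E
    using assms(1) by (simp add: atomic_def indicator_def sum.inter_restrict if_distrib cong: if_cong)
  show ?thesis
    unfolding eq by (intro sums_sum sums_mult ind)
qed

text \<open>The triangle inequality bounds every partition, and a Hahn decomposition attains the
  bound: atoms in \<open>P\<close> have nonnegative weight and those in \<open>E - P\<close>
  negative weight, so neither piece sees cancellation.\<close>

lemma variation_atomic:
  assumes F: "finite F" and FM: "\<And>G. G \<subseteq> F \<Longrightarrow> G \<in> sets M" and E: "E \<in> sets M"
  shows "variation M (atomic F a) E = ennreal (atomic F (\<lambda>x. \<bar>a x\<bar>) E)"
proof (rule antisym)
  show "variation M (atomic F a) E \<le> ennreal (atomic F (\<lambda>x. \<bar>a x\<bar>) E)"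
    unfolding variation_def
  proof (rule SUP_least, clarify)
    fix A :: "nat \<Rightarrow> 'a set" assume A: "disjoint_family A"
    have "(\<Sum>i. ennreal \<bar>atomic F a (A i)\<bar>) \<le> (\<Sum>i. ennreal (atomic F (\<lambda>x. \<bar>a x\<bar>) (A i)))"
      by (intro suminf_le) (auto simp: atomic_def intro!: ennreal_leI sum_abs)
    also have "\<dots> = ennreal (atomic F (\<lambda>x. \<bar>a x\<bar>) (\<Union>i. A i))"
      by (intro suminf_ennreal_eq atomic_sums F A) (simp add: atomic_def sum_nonneg)
    finally show "(\<Sum>i. ennreal \<bar>atomic F a (A i)\<bar>) \<le> ennreal (atomic F (\<lambda>x. \<bar>a x\<bar>) (\<Union>i. A i))" .
  qed
next
  define P where "P = {x \<in> F \<inter> E. a x \<ge> 0}"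
  define A where "A = (\<lambda>i::nat. if i = 0 then P else if i = 1 then E - P else {})"
  have "P \<in> sets M" by (rule FM) (auto simp: P_def)
  then have "range A \<subseteq> sets M" "disjoint_family A" "(\<Union>i. A i) = E"
    using E by (auto simp: A_def P_def disjoint_family_on_def split: if_splits)
  then have le: "(\<Sum>i. ennreal \<bar>atomic F a (A i)\<bar>) \<le> variation M (atomic F a) E"
    unfolding variation_def by (intro SUP_upper) auto
  have pos: "\<bar>atomic F a P\<bar> = (\<Sum>x\<in>P. \<bar>a x\<bar>)"
  proof -
    have "F \<inter> P = P" by (auto simp: P_def)
    moreover have "(\<Sum>x\<in>P. a x) = (\<Sum>x\<in>P. \<bar>a x\<bar>)" by (intro sum.cong) (auto simp: P_def)
    ultimately show ?thesis by (simp add: atomic_def sum_nonneg)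
  qed
  have neg: "\<bar>atomic F a (E - P)\<bar> = (\<Sum>x\<in>F \<inter> (E - P). \<bar>a x\<bar>)"
  proof -
    have "(\<Sum>x\<in>F \<inter> (E - P). a x) = (\<Sum>x\<in>F \<inter> (E - P). - \<bar>a x\<bar>)"
      by (intro sum.cong) (auto simp: P_def)
    then show ?thesis by (simp add: atomic_def sum_negf sum_nonneg)
  qed
  have "atomic F (\<lambda>x. \<bar>a x\<bar>) E = (\<Sum>x\<in>P \<union> (F \<inter> (E - P)). \<bar>a x\<bar>)"
    unfolding atomic_def by (intro sum.cong) (auto simp: P_def)
  also have "\<dots> = \<bar>atomic F a P\<bar> + \<bar>atomic F a (E - P)\<bar>"
    unfolding pos neg using F by (intro sum.union_disjoint) (auto simp: P_def)
  finally have "ennreal (atomic F (\<lambda>x. \<bar>a x\<bar>) E) = (\<Sum>i<2. ennreal \<bar>atomic F a (A i)\<bar>)"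
    by (simp add: A_def numeral_2_eq_2)
  also have "\<dots> \<le> (\<Sum>i. ennreal \<bar>atomic F a (A i)\<bar>)"
    by (intro sum_le_suminf) auto
  finally show "ennreal (atomic F (\<lambda>x. \<bar>a x\<bar>) E) \<le> variation M (atomic F a) E"
    using le by (rule order_trans)
qed

text \<open>Here the exact integral is wanted, so \<open>measure_of\<close> must not fall back to
  the null measure. A genuine measure with the values \<open>\<nu>\<close> rules this out: the point
  measure on \<open>F\<close>, pushed forward along \<open>id\<close> to the sigma-algebra of
  \<open>M\<close>.\<close>

lemma integral_measure_of_atomic:
  fixes f :: "'a \<Rightarrow> 'b::euclidean_space"
  assumes F: "finite F" "F \<subseteq> space M" and f: "f \<in> borel_measurable M"
    and b: "\<And>x. x \<in> F \<Longrightarrow> 0 \<le> b x"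
    and \<nu>: "\<And>E. E \<in> sets M \<Longrightarrow> \<nu> E = ennreal (atomic F b E)"
  shows "(LINT x|measure_of (space M) (sets M) \<nu>. f x) = (\<Sum>x\<in>F. b x *\<^sub>R f x)"
proof -
  define P where "P = point_measure F (\<lambda>x. ennreal (b x))"
  define N where "N = distr P M id"
  have idm: "id \<in> measurable P M"
    using F by (auto simp: P_def)
  have "emeasure N E = \<nu> E" if "E \<in> sets M" for E
  proof -
    have "emeasure N E = emeasure P (F \<inter> E)"
      unfolding N_def by (subst emeasure_distr[OF idm that])
        (simp add: P_def space_point_measure Int_commute)
    also have "\<dots> = (\<Sum>x\<in>F \<inter> E. ennreal (b x))"
      unfolding P_def by (rule emeasure_point_measure_finite) (use F in auto)
    also have "\<dots> = \<nu> E"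
      unfolding \<nu>[OF that] atomic_def by (rule sum_ennreal) (use b in auto)
    finally show ?thesis .
  qed
  then have "measure_of (space M) (sets M) \<nu> = measure_of (space M) (sets M) (emeasure N)"
    by (intro measure_of_eq sets.space_closed) (simp add: sets.sigma_sets_eq)
  also have "\<dots> = N"
    using measure_of_of_measure[of N] by (simp add: N_def)
  finally have "(LINT x|measure_of (space M) (sets M) \<nu>. f x) = (LINT x|N. f x)" by simp
  also have "\<dots> = (LINT x|P. f x)"
    unfolding N_def by (subst integral_distr[OF idm f]) simp
  also have "\<dots> = (\<Sum>x\<in>F. b x *\<^sub>R f x)"
    unfolding P_def by (rule lebesgue_integral_point_measure_finite) (use F b in auto)
  finally show ?thesis .
qed

lemma atomic_radon:
  fixes f :: "'a::t2_space \<Rightarrow> 'b::euclidean_space"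
  assumes T: "compact T" and F: "finite F" "F \<subseteq> T" and f: "continuous_on T f"
  shows "signed_radon_measure T (atomic F a)"
    and "tv_norm T (atomic F a) = (\<Sum>x\<in>F. \<bar>a x\<bar>)"
    and "signed_integral (restrict_space borel T) (atomic F a) f = (\<Sum>x\<in>F. a x *\<^sub>R f x)"
proof -
  define M where "M = restrict_space borel T"
  have TM: "T \<in> sets M" and sp: "space M = T"
    using T by (auto simp: M_def sets_restrict_space_iff compact_imp_closed space_restrict_space)
  have FM: "G \<in> sets M" if "G \<subseteq> F" for G
  proof -
    have "finite G" using that F(1) finite_subset by blast
    then have "closed G" by (rule finite_imp_closed)
    then show ?thesis
      using that F T by (auto simp: M_def sets_restrict_space_iff compact_imp_closed)
  qed
  note var = variation_atomic[OF F(1) FM, simplified]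
  show "signed_radon_measure T (atomic F a)"
    unfolding signed_radon_measure_def Let_def M_def[symmetric]
  proof (intro conjI ballI impI)
    show "signed_measure M (atomic F a)"
      unfolding signed_measure_def using atomic_sums[OF F(1)] by (auto simp: atomic_def)
    show "variation M (atomic F a) C < \<infinity>" if "C \<in> sets M" for C
      by (simp add: var that)
    fix E assume E: "E \<in> sets M"
    show "variation M (atomic F a) E
        = (SUP C\<in>{C \<in> sets M. compact C \<and> C \<subseteq> E}. variation M (atomic F a) C)"
    proof (rule antisym)
      \<comment> \<open>\<open>F \<inter> E\<close> is a compact subset of \<open>E\<close> that
        carries all of its variation, which gives inner regularity.\<close>
      have FE: "F \<inter> E \<in> sets M" "compact (F \<inter> E)" using F by (auto intro: FM finite_imp_compact)
      have "variation M (atomic F a) E = variation M (atomic F a) (F \<inter> E)"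
        by (simp add: var E FE atomic_def Int_left_absorb)
      then show "variation M (atomic F a) E
          \<le> (SUP C\<in>{C \<in> sets M. compact C \<and> C \<subseteq> E}. variation M (atomic F a) C)"
        using FE by (auto intro!: SUP_upper)
    next
      show "(SUP C\<in>{C \<in> sets M. compact C \<and> C \<subseteq> E}. variation M (atomic F a) C)
          \<le> variation M (atomic F a) E"
        using F(1) by (auto intro!: SUP_least ennreal_leI sum_mono2 simp: var E atomic_def)
    qed
  qed
  have nn: "atomic F (\<lambda>x. \<bar>a x\<bar>) E \<ge> 0" for E by (simp add: atomic_def sum_nonneg)
  show "tv_norm T (atomic F a) = (\<Sum>x\<in>F. \<bar>a x\<bar>)"
    using F nn[of T] by (simp add: tv_norm_def M_def[symmetric] var TM atomic_def Int_absorb2)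
  have meas: "f \<in> borel_measurable M"
    unfolding M_def using f by (rule borel_measurable_continuous_on_restrict)
  \<comment> \<open>The average of variation and value is again atomic; its weights are the positive
    parts of the \<open>a x\<close>.\<close>
  have "(LINT x|pos_part M (atomic F a). f x) = (\<Sum>x\<in>F. ((\<bar>a x\<bar> + a x) / 2) *\<^sub>R f x)"
    unfolding pos_part_def using F(2) nn
    by (intro integral_measure_of_atomic F(1) meas)
       (auto simp: sp var, simp add: atomic_def sum_divide_distrib[symmetric] sum.distrib)
  moreover have "(LINT x|neg_part M (atomic F a). f x) = (\<Sum>x\<in>F. ((\<bar>a x\<bar> - a x) / 2) *\<^sub>R f x)"
    unfolding neg_part_def using F(2) nn
    by (intro integral_measure_of_atomic F(1) meas)
       (auto simp: sp var, simp add: atomic_def sum_divide_distrib[symmetric] sum_subtractf)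
  ultimately show "signed_integral (restrict_space borel T) (atomic F a) f = (\<Sum>x\<in>F. a x *\<^sub>R f x)"
    unfolding signed_integral_def M_def[symmetric]
    by (simp add: sum_subtractf[symmetric] scaleR_diff_left[symmetric] diff_divide_distrib[symmetric])
qed

text \<open>The points \<open>\<theta> k\<close> may coincide. Their weights are then added,
  possibly with cancellation, so the norm is only bounded by the sum of the
  \<open>\<bar>c k\<bar>\<close>.\<close>

lemma ex_atomic_measure:
  fixes f :: "'a::t2_space \<Rightarrow> 'b::euclidean_space"
  assumes T: "compact T" and I: "finite I" "\<theta> ` I \<subseteq> T" and f: "continuous_on T f"
  obtains \<mu> where "signed_radon_measure T \<mu>" "tv_norm T \<mu> \<le> (\<Sum>k\<in>I. \<bar>c k\<bar>)"
    "signed_integral (restrict_space borel T) \<mu> f = (\<Sum>k\<in>I. c k *\<^sub>R f (\<theta> k))"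
proof -
  define F where "F = \<theta> ` I"
  define a where "a x = (\<Sum>k\<in>{k \<in> I. \<theta> k = x}. c k)" for x
  have F: "finite F" "F \<subseteq> T" using I by (auto simp: F_def)
  have "(\<Sum>x\<in>F. \<bar>a x\<bar>) \<le> (\<Sum>x\<in>F. \<Sum>k\<in>{k \<in> I. \<theta> k = x}. \<bar>c k\<bar>)"
    unfolding a_def by (intro sum_mono sum_abs)
  also have "\<dots> = (\<Sum>k\<in>I. \<bar>c k\<bar>)"
    unfolding F_def by (rule sum.image_gen[OF I(1), symmetric])
  finally have tv: "tv_norm T (atomic F a) \<le> (\<Sum>k\<in>I. \<bar>c k\<bar>)"
    using atomic_radon(2)[OF T F f] by simp
  have "(\<Sum>x\<in>F. a x *\<^sub>R f x) = (\<Sum>x\<in>F. \<Sum>k\<in>{k \<in> I. \<theta> k = x}. c k *\<^sub>R f (\<theta> k))"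
    unfolding a_def scaleR_sum_left by (intro sum.cong refl) auto
  also have "\<dots> = (\<Sum>k\<in>I. c k *\<^sub>R f (\<theta> k))"
    unfolding F_def by (rule sum.image_gen[OF I(1), symmetric])
  finally have "signed_integral (restrict_space borel T) (atomic F a) f = (\<Sum>k\<in>I. c k *\<^sub>R f (\<theta> k))"
    using atomic_radon(3)[OF T F f] by simp
  then show thesis using that atomic_radon(1)[OF T F f] tv by blast
qed


section \<open>Convex duality\<close>

text \<open>The last two conclusions are first-order optimality conditions at a minimizer of
  \<open>\<phi>\<close>, for the direction \<open>s\<close> and for shrinking
  \<open>t\<close>.\<close>

lemma gauge_minimizer:
  fixes C :: "'b::euclidean_space set"
  assumes C: "compact C" "convex C" "C \<noteq> {}" and \<beta>: "0 < \<beta>"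
  obtains t z where "0 \<le> t" "z \<in> C" "\<And>s. s \<in> C \<Longrightarrow> (y - t *\<^sub>R z) \<bullet> s \<le> \<beta>"
    "\<beta> * t \<le> (y - t *\<^sub>R z) \<bullet> (t *\<^sub>R z)"
proof -
  define \<phi> where "\<phi> = (\<lambda>(t, z). 1/2 * (norm (t *\<^sub>R z - y))\<^sup>2 + \<beta> * t)"
  \<comment> \<open>For \<open>t > b\<close> the penalty \<open>\<beta> * t\<close> alone exceeds
    half the squared norm of \<open>y\<close>, the value of \<open>\<phi>\<close> at
    \<open>t = 0\<close>; so a minimum over \<open>t \<le> b\<close> is global.\<close>
  define b where "b = (norm y)\<^sup>2 / (2 * \<beta>)"
  have "b \<ge> 0" using \<beta> by (simp add: b_def)
  obtain z0 where z0: "z0 \<in> C" using C by auto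
  have "continuous_on ({0..b} \<times> C) \<phi>"
    unfolding \<phi>_def case_prod_beta by (intro continuous_intros)
  moreover have "compact ({0..b} \<times> C)" using C by (intro compact_Times) auto
  moreover have "{0..b} \<times> C \<noteq> {}" using C \<open>b \<ge> 0\<close> by auto
  ultimately obtain p where p: "p \<in> {0..b} \<times> C" and pmin: "\<And>q. q \<in> {0..b} \<times> C \<Longrightarrow> \<phi> p \<le> \<phi> q"
    using continuous_attains_inf[of "{0..b} \<times> C" \<phi>] by blast
  obtain t z where tz: "p = (t, z)" by (cases p)
  have t: "0 \<le> t" and z: "z \<in> C" using p tz by auto
  have min: "\<phi> (t, z) \<le> \<phi> (s, w)" if "0 \<le> s" "w \<in> C" for s w
  proof (cases "s \<le> b")
    case True
    then show ?thesis using pmin[of "(s, w)"] that tz by auto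
  next
    case False
    then have "1/2 * (norm y)\<^sup>2 \<le> \<beta> * s" using \<beta> by (simp add: b_def field_simps)
    moreover have "\<phi> (t, z) \<le> 1/2 * (norm y)\<^sup>2"
      using pmin[of "(0, z0)"] tz z0 \<open>b \<ge> 0\<close> by (simp add: \<phi>_def)
    moreover have "\<phi> (s, w) \<ge> \<beta> * s" by (simp add: \<phi>_def)
    ultimately show ?thesis by linarith
  qed
  define u where "u = t *\<^sub>R z"
  define v where "v = y - u"
  have expand: "1/2 * (norm (u + d - y))\<^sup>2 = 1/2 * (norm (u - y))\<^sup>2 - v \<bullet> d + 1/2 * (norm d)\<^sup>2" for d
    unfolding v_def power2_norm_eq_inner by (simp add: algebra_simps inner_commute)
  \<comment> \<open>Division by \<open>e\<close> and passage to the limit \<open>e\<close> to 0,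
    which discards the quadratic remainder.\<close>
  have limit: "x \<le> \<beta>'" if "\<And>e. 0 < e \<Longrightarrow> e \<le> 1 \<Longrightarrow> e * x \<le> e * \<beta>' + e\<^sup>2 * r" for x \<beta>' r :: real
  proof (rule field_le_epsilon)
    fix e :: real assume "0 < e"
    define h where "h = min 1 (e / (\<bar>r\<bar> + 1))"
    have h: "0 < h" "h \<le> 1" using \<open>0 < e\<close> by (auto simp: h_def)
    have "h * x \<le> h * (\<beta>' + h * r)" using that[OF h] by (simp add: power2_eq_square algebra_simps)
    then have "x \<le> \<beta>' + h * r" using h by simp
    also have "h * r \<le> h * (\<bar>r\<bar> + 1)" using h by (intro mult_left_mono) auto
    also have "\<dots> \<le> e"
    proof -
      have "h \<le> e / (\<bar>r\<bar> + 1)" by (simp add: h_def)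
      then show ?thesis by (simp add: pos_le_divide_eq)
    qed
    finally show "x \<le> \<beta>' + e" by simp
  qed
  have "v \<bullet> s \<le> \<beta>" if s: "s \<in> C" for s
  proof (rule limit)
    fix e :: real assume e: "0 < e"
    \<comment> \<open>The convex combination for which \<open>(t + e) *\<^sub>R w\<close> is
      \<open>u + e *\<^sub>R s\<close>: adding \<open>e *\<^sub>R s\<close> costs exactly
      \<open>\<beta> * e\<close> in the penalty.\<close>
    define w where "w = (t / (t + e)) *\<^sub>R z + (e / (t + e)) *\<^sub>R s"
    have "w \<in> C"
      unfolding w_def using t e by (intro convexD[OF C(2) z s])
        (auto simp: add_divide_distrib[symmetric])
    moreover have "(t + e) *\<^sub>R w = u + e *\<^sub>R s"
      unfolding w_def u_def using t e by (simp add: scaleR_add_right)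
    ultimately have "1/2 * (norm (u - y))\<^sup>2 + \<beta> * t \<le> 1/2 * (norm (u + e *\<^sub>R s - y))\<^sup>2 + \<beta> * (t + e)"
      using min[of "t + e" w] t e by (simp add: \<phi>_def u_def)
    then show "e * (v \<bullet> s) \<le> e * \<beta> + e\<^sup>2 * (1/2 * (norm s)\<^sup>2)"
      unfolding expand by (simp add: algebra_simps power_mult_distrib)
  qed
  moreover have "\<beta> * t \<le> v \<bullet> u"
  proof (rule limit)
    fix e :: real assume e: "0 < e" "e \<le> 1"
    have "(t * (1 - e)) *\<^sub>R z = u + (- e) *\<^sub>R u" by (simp add: u_def algebra_simps)
    then have "1/2 * (norm (u - y))\<^sup>2 + \<beta> * t \<le> 1/2 * (norm (u + (- e) *\<^sub>R u - y))\<^sup>2 + \<beta> * (t * (1 - e))"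
      using min[of "t * (1 - e)" z] t e z by (simp add: \<phi>_def u_def)
    then show "e * (\<beta> * t) \<le> e * (v \<bullet> u) + e\<^sup>2 * (1/2 * (norm u)\<^sup>2)"
      unfolding expand by (simp add: algebra_simps power_mult_distrib)
  qed
  ultimately show thesis using that[OF t z] by (simp add: u_def v_def)
qed

text \<open>Caratheodory leaves at most \<open>DIM('b) + 1\<close> points; a point from the negated
  copy puts its sign into the coefficient, and zero coefficients pad the sum to \<open>K\<close>
  terms.\<close>

lemma symmetric_convex_hull_atoms:
  fixes f :: "'a \<Rightarrow> 'b::euclidean_space"
  assumes z: "z \<in> convex hull (f ` T \<union> uminus ` f ` T)" and K: "DIM('b) + 1 \<le> K"
  obtains c :: "nat \<Rightarrow> real" and \<theta> where "\<And>k. \<theta> k \<in> T" "(\<Sum>k=1..K. \<bar>c k\<bar>) \<le> 1"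
    "(\<Sum>k=1..K. c k *\<^sub>R f (\<theta> k)) = z"
proof -
  obtain S where S: "finite S" "S \<subseteq> f ` T \<union> uminus ` f ` T" "card S \<le> DIM('b) + 1" "z \<in> convex hull S"
    using z unfolding caratheodory[of "f ` T \<union> uminus ` f ` T"] by blast
  then obtain u where u: "\<And>x. x \<in> S \<Longrightarrow> 0 \<le> u x" "sum u S = 1" "(\<Sum>x\<in>S. u x *\<^sub>R x) = z"
    unfolding convex_hull_finite[OF S(1)] by auto
  have "\<forall>x\<in>S. \<exists>\<tau> \<sigma>. \<tau> \<in> T \<and> \<bar>\<sigma>\<bar> = 1 \<and> x = \<sigma> *\<^sub>R f \<tau>"
  proof
    fix x assume "x \<in> S"
    then consider \<tau> where "\<tau> \<in> T" "x = f \<tau>" | \<tau> where "\<tau> \<in> T" "x = - f \<tau>" using S(2) by auto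
    then show "\<exists>\<tau> \<sigma>. \<tau> \<in> T \<and> \<bar>\<sigma>\<bar> = (1::real) \<and> x = \<sigma> *\<^sub>R f \<tau>"
    proof cases
      case 1 then show ?thesis by (intro exI[of _ \<tau>] exI[of _ 1]) auto
    next
      case 2 then show ?thesis by (intro exI[of _ \<tau>] exI[of _ "-1"]) auto
    qed
  qed
  then obtain \<tau> \<sigma> where \<tau>: "\<And>x. x \<in> S \<Longrightarrow> \<tau> x \<in> T" "\<And>x. x \<in> S \<Longrightarrow> \<bar>\<sigma> x\<bar> = 1"
      "\<And>x. x \<in> S \<Longrightarrow> x = \<sigma> x *\<^sub>R f (\<tau> x)" by metis
  obtain h where h: "bij_betw h {1..card S} S" using ex_bij_betw_nat_finite_1[OF S(1)] by blast
  have "S \<noteq> {}" using S(4) by auto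
  then obtain x0 where x0: "x0 \<in> S" by auto
  define J where "J = {1..card S}"
  have J: "J \<subseteq> {1..K}" using S(3) K by (auto simp: J_def)
  have hS: "h k \<in> S" if "k \<in> J" for k using h that by (auto simp: bij_betw_def J_def)
  \<comment> \<open>Padding indices have coefficient 0, but their parameters must still lie in
    \<open>T\<close>; \<open>x0\<close> provides one.\<close>
  define \<theta> where "\<theta> k = \<tau> (if k \<in> J then h k else x0)" for k
  define c where "c k = (if k \<in> J then u (h k) * \<sigma> (h k) else 0)" for k
  have "(\<Sum>k=1..K. \<bar>c k\<bar>) = (\<Sum>k\<in>J. \<bar>c k\<bar>)"
    using J by (intro sum.mono_neutral_right) (auto simp: c_def)
  also have "\<dots> = (\<Sum>k\<in>J. u (h k))"
    using u(1) \<tau>(2) hS by (intro sum.cong) (auto simp: c_def abs_mult)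
  also have "\<dots> = 1" using sum.reindex_bij_betw[OF h, of u] u(2) by (simp add: J_def)
  finally have 1: "(\<Sum>k=1..K. \<bar>c k\<bar>) \<le> 1" by simp
  have "(\<Sum>k=1..K. c k *\<^sub>R f (\<theta> k)) = (\<Sum>k\<in>J. c k *\<^sub>R f (\<theta> k))"
    using J by (intro sum.mono_neutral_right) (auto simp: c_def)
  also have "\<dots> = (\<Sum>k\<in>J. u (h k) *\<^sub>R h k)"
  proof (rule sum.cong[OF refl])
    fix k assume k: "k \<in> J"
    then have "c k *\<^sub>R f (\<theta> k) = u (h k) *\<^sub>R (\<sigma> (h k) *\<^sub>R f (\<tau> (h k)))" by (simp add: c_def \<theta>_def)
    then show "c k *\<^sub>R f (\<theta> k) = u (h k) *\<^sub>R h k" using \<tau>(3)[OF hS[OF k]] by simp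
  qed
  also have "\<dots> = z"
    using sum.reindex_bij_betw[OF h, of "\<lambda>x. u x *\<^sub>R x"] u(3) by (simp add: J_def)
  finally show thesis using that[of \<theta> c] 1 \<tau>(1) hS x0 by (auto simp: \<theta>_def)
qed

text \<open>The order of quantifiers matters: \<open>v\<close> does not depend on \<open>K\<close>.
  The inequality in the second conclusion suffices, since weak duality supplies the reverse
  one.\<close>

lemma dual_certificate:
  fixes f :: "'a::topological_space \<Rightarrow> 'b::euclidean_space"
  assumes T: "compact T" "T \<noteq> {}" and f: "continuous_on T f" and \<beta>: "0 < \<beta>"
  obtains v where "\<And>x. x \<in> T \<Longrightarrow> \<bar>v \<bullet> f x\<bar> \<le> \<beta>"
    "\<And>K. DIM('b) + 1 \<le> K \<Longrightarrow> \<exists>(c :: nat \<Rightarrow> real) \<theta>. (\<forall>k. \<theta> k \<in> T) \<and>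
       1/2 * (norm ((\<Sum>k=1..K. c k *\<^sub>R f (\<theta> k)) - y))\<^sup>2 + \<beta> * (\<Sum>k=1..K. \<bar>c k\<bar>)
         \<le> - 1/2 * (norm (v - y))\<^sup>2 + 1/2 * (norm y)\<^sup>2"
proof -
  define S where "S = f ` T \<union> uminus ` f ` T"
  have "compact S"
    using compact_continuous_image[OF f T(1)] by (auto simp: S_def intro: compact_negations compact_Un)
  then have C: "compact (convex hull S)" "convex (convex hull S)" "convex hull S \<noteq> {}"
    using T(2) by (auto simp: compact_convex_hull S_def)
  obtain t z where t: "0 \<le> t" and z: "z \<in> convex hull S"
    and s: "\<And>s. s \<in> convex hull S \<Longrightarrow> (y - t *\<^sub>R z) \<bullet> s \<le> \<beta>"
    and tz: "\<beta> * t \<le> (y - t *\<^sub>R z) \<bullet> (t *\<^sub>R z)"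
    using gauge_minimizer[OF C \<beta>, of y] by metis
  define v where "v = y - t *\<^sub>R z"
  show thesis
  proof (rule that[of v])
    fix x assume "x \<in> T"
    then have "f x \<in> convex hull S" "- f x \<in> convex hull S" by (auto simp: S_def intro!: hull_inc)
    from this[THEN s] show "\<bar>v \<bullet> f x\<bar> \<le> \<beta>" by (auto simp: v_def)
  next
    fix K :: nat assume "DIM('b) + 1 \<le> K"
    then obtain c :: "nat \<Rightarrow> real" and \<theta> where c: "\<And>k. \<theta> k \<in> T" "(\<Sum>k=1..K. \<bar>c k\<bar>) \<le> 1"
      "(\<Sum>k=1..K. c k *\<^sub>R f (\<theta> k)) = z"
      using symmetric_convex_hull_atoms[OF z[unfolded S_def], of K] by metis
    have u: "(\<Sum>k=1..K. (t * c k) *\<^sub>R f (\<theta> k)) = t *\<^sub>R z"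
      unfolding c(3)[symmetric] by (simp add: scaleR_sum_right)
    have "\<beta> * (\<Sum>k=1..K. \<bar>t * c k\<bar>) \<le> \<beta> * t"
    proof -
      have "(\<Sum>k=1..K. \<bar>t * c k\<bar>) = t * (\<Sum>k=1..K. \<bar>c k\<bar>)"
        using t by (simp add: abs_mult sum_distrib_left)
      also have "\<dots> \<le> t" using c(2) t by (simp add: mult_left_le)
      finally show ?thesis using \<beta> by simp
    qed
    \<comment> \<open>Equality case of weak duality: \<open>v\<close> is the residual of
      \<open>t *\<^sub>R z\<close>, so the square that measures the gap vanishes.\<close>
    moreover have "1/2 * (norm (t *\<^sub>R z - y))\<^sup>2 + (y - t *\<^sub>R z) \<bullet> (t *\<^sub>R z)
        = - 1/2 * (norm (v - y))\<^sup>2 + 1/2 * (norm y)\<^sup>2"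
      unfolding v_def power2_norm_eq_inner by (simp add: algebra_simps inner_commute)
    ultimately have "1/2 * (norm ((\<Sum>k=1..K. (t * c k) *\<^sub>R f (\<theta> k)) - y))\<^sup>2 + \<beta> * (\<Sum>k=1..K. \<bar>t * c k\<bar>)
         \<le> - 1/2 * (norm (v - y))\<^sup>2 + 1/2 * (norm y)\<^sup>2"
      unfolding u using tz by linarith
    then show "\<exists>(c :: nat \<Rightarrow> real) \<theta>. (\<forall>k. \<theta> k \<in> T) \<and>
       1/2 * (norm ((\<Sum>k=1..K. c k *\<^sub>R f (\<theta> k)) - y))\<^sup>2 + \<beta> * (\<Sum>k=1..K. \<bar>c k\<bar>)
         \<le> - 1/2 * (norm (v - y))\<^sup>2 + 1/2 * (norm y)\<^sup>2"
      using c(1) by (intro exI[of _ "\<lambda>k. t * c k"] exI[of _ \<theta>]) auto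
  qed
qed

text \<open>Completing the square: with \<open>v \<bullet> u\<close> in place of \<open>r\<close>,
  the gap is half the squared norm of \<open>u + v - y\<close>. The regularizer enters through
  \<open>r\<close>, so measures and networks share this lemma.\<close>

lemma weak_duality:
  fixes u v y :: "'b::real_inner"
  assumes "v \<bullet> u \<le> r"
  shows "- 1/2 * (norm (v - y))\<^sup>2 + 1/2 * (norm y)\<^sup>2 \<le> 1/2 * (norm (u - y))\<^sup>2 + r"
proof -
  have "1/2 * (norm (u - y))\<^sup>2 + v \<bullet> u - (- 1/2 * (norm (v - y))\<^sup>2 + 1/2 * (norm y)\<^sup>2)
      = 1/2 * (norm (u + v - y))\<^sup>2"
    unfolding power2_norm_eq_inner by (simp add: algebra_simps inner_commute)
  then show ?thesis using assms zero_le_power2[of "norm (u + v - y)"] by linarith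
qed


section \<open>The three problems\<close>

lemma subnet_eq: "subnet X (A, b) = relu_vec (relu_mat (X ** A) *v b)"
  by (simp add: subnet_def)

lemma subnet_scale:
  assumes "0 \<le> r"
  shows "subnet X (A, r *\<^sub>R b) = r *\<^sub>R subnet X (A, b)"
  using assms
  by (simp add: subnet_eq relu_vec_def vec_eq_iff matrix_vector_mult_scaleR max_mult_distrib_left)

lemma continuous_on_subnet: "continuous_on S (subnet X)"
proof -
  have "continuous_on S (\<lambda>\<theta>. \<chi> i. max (\<Sum>j\<in>UNIV. max (\<Sum>k\<in>UNIV. X $ i $ k * fst \<theta> $ k $ j) 0 * snd \<theta> $ j) 0)"
    by (intro continuous_intros)
  then show ?thesis
    by (rule continuous_on_eq)
       (simp add: subnet_def case_prod_beta relu_vec_def relu_mat_def matrix_vector_mult_def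
          matrix_matrix_mult_def)
qed

lemma Theta_p_eq: "Theta_p = cball 0 1 \<times> cball 0 1"
  by (auto simp: Theta_p_def)

lemma compact_Theta_p: "compact Theta_p"
  unfolding Theta_p_eq by (intro compact_Times compact_cball)

text \<open>The primal problem leaves \<open>w2\<close> unbounded, whereas dual feasibility speaks
  of the unit ball; positive homogeneity in \<open>b\<close> bridges the two.\<close>

lemma inner_subnet_le:
  fixes X :: "real^'d^'n" and A :: "real^'m^'d"
  assumes v: "\<And>\<theta>. \<theta> \<in> (Theta_p :: ((real^'m^'d) \<times> (real^'m)) set) \<Longrightarrow> \<bar>v \<bullet> subnet X \<theta>\<bar> \<le> \<beta>"
    and A: "norm A \<le> 1"
  shows "\<bar>v \<bullet> subnet X (A, b)\<bar> \<le> \<beta> * norm b"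
proof -
  have "subnet X (A, b) = norm b *\<^sub>R subnet X (A, sgn b)"
    using subnet_scale[of "norm b" X A "sgn b"] by (cases "b = 0") (simp_all add: sgn_div_norm)
  moreover have "\<bar>v \<bullet> subnet X (A, sgn b)\<bar> \<le> \<beta>"
    using A by (intro v) (auto simp: Theta_p_def norm_sgn)
  ultimately show ?thesis
    by (simp add: abs_mult mult.commute[of \<beta>] mult_left_mono)
qed

text \<open>A real-valued \<open>SUP\<close> is meaningful only for a bounded family; continuity on
  the compact parameter set provides the bound.\<close>

lemma dual_feasible_iff:
  fixes X :: "real^'d^'n" and v :: "real^'n"
  shows "(SUP \<theta> \<in> (Theta_p :: ((real^'m^'d) \<times> (real^'m)) set). \<bar>v \<bullet> subnet X \<theta>\<bar>) \<le> \<beta>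
    \<longleftrightarrow> (\<forall>\<theta> \<in> (Theta_p :: ((real^'m^'d) \<times> (real^'m)) set). \<bar>v \<bullet> subnet X \<theta>\<bar> \<le> \<beta>)"
proof (rule cSUP_le_iff)
  show "(Theta_p :: ((real^'m^'d) \<times> (real^'m)) set) \<noteq> {}" by (auto simp: Theta_p_eq)
  have "continuous_on (Theta_p :: ((real^'m^'d) \<times> (real^'m)) set) (\<lambda>\<theta>. \<bar>v \<bullet> subnet X \<theta>\<bar>)"
    by (intro continuous_intros continuous_on_subnet)
  from compact_imp_bounded[OF compact_continuous_image[OF this compact_Theta_p]]
  show "bdd_above ((\<lambda>\<theta>. \<bar>v \<bullet> subnet X \<theta>\<bar>) ` (Theta_p :: ((real^'m^'d) \<times> (real^'m)) set))"
    by (rule bounded_imp_bdd_above)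
qed

text \<open>Coercivity: the weight decay controls \<open>w2\<close> and \<open>w3\<close>, the
  constraint controls \<open>W1\<close>, so the search can be confined to a compact set. This works
  for every \<open>K\<close>.\<close>

lemma primal_min:
  fixes X :: "real^'d^'n" and y :: "real^'n"
  assumes \<beta>: "0 < \<beta>"
  shows "P_star TYPE('m::finite) X y \<beta> K \<in> primal_values TYPE('m) X y \<beta> K"
proof -
  define \<phi> :: "(nat \<Rightarrow> (real^'m^'d) \<times> (real^'m) \<times> real) \<Rightarrow> real" where
    "\<phi> g = 1/2 * (norm ((\<Sum>k=1..K. snd (snd (g k)) *\<^sub>R subnet X (fst (g k), fst (snd (g k)))) - y))\<^sup>2
        + \<beta>/2 * (\<Sum>k=1..K. (norm (fst (snd (g k))))\<^sup>2 + (snd (snd (g k)))\<^sup>2)" for g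
  have vals: "primal_values TYPE('m) X y \<beta> K = \<phi> ` {g. \<forall>k\<in>{1..K}. norm (fst (g k)) \<le> 1}" (is "_ = \<phi> ` ?G")
  proof
    show "primal_values TYPE('m) X y \<beta> K \<subseteq> \<phi> ` ?G"
    proof
      fix x assume "x \<in> primal_values TYPE('m) X y \<beta> K"
      then obtain W1 :: "nat \<Rightarrow> real^'m^'d" and w2 w3 where
        "x = 1/2 * (norm ((\<Sum>k=1..K. w3 k *\<^sub>R relu_vec (relu_mat (X ** W1 k) *v w2 k)) - y))\<^sup>2
          + \<beta>/2 * (\<Sum>k=1..K. (norm (w2 k))\<^sup>2 + (w3 k)\<^sup>2)" "\<forall>k\<in>{1..K}. norm (W1 k) \<le> 1"
        unfolding primal_values_def by blast
      then show "x \<in> \<phi> ` ?G"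
        by (intro image_eqI[of _ _ "\<lambda>k. (W1 k, w2 k, w3 k)"]) (simp_all add: \<phi>_def subnet_eq)
    qed
  next
    show "\<phi> ` ?G \<subseteq> primal_values TYPE('m) X y \<beta> K"
    proof clarify
      fix g :: "nat \<Rightarrow> (real^'m^'d) \<times> (real^'m) \<times> real"
      assume g: "\<forall>k\<in>{1..K}. norm (fst (g k)) \<le> 1"
      show "\<phi> g \<in> primal_values TYPE('m) X y \<beta> K"
        unfolding primal_values_def \<phi>_def subnet_eq mem_Collect_eq
        by (rule exI[of _ "\<lambda>k. fst (g k)"], rule exI[of _ "\<lambda>k. fst (snd (g k))"],
            rule exI[of _ "\<lambda>k. snd (snd (g k))"]) (use g in auto)
    qed
  qed
  \<comment> \<open>Chosen so that \<open>\<beta>/2 * R\<^sup>2\<close> equals the objective of the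
    zero network; one outer weight of norm above \<open>R\<close> already costs at least that
    much.\<close>
  define R where "R = norm y / sqrt \<beta>"
  define D where "D = (cball 0 1 :: (real^'m^'d) set) \<times> (cball 0 R :: (real^'m) set) \<times> (cball 0 R :: real set)"
  \<comment> \<open>Networks are functions on all of \<open>nat\<close>. Pinning the coordinates
    outside \<open>{1..K}\<close>, which \<open>\<phi>\<close> ignores, to 0 makes every factor
    compact, so that the product is compact.\<close>
  define C where "C = PiE UNIV (\<lambda>k. if k \<in> {1..K} then D else {0})"
  have "R \<ge> 0" using \<beta> by (simp add: R_def)
  have "compact C"
  proof -
    have "compactin (product_topology (\<lambda>_. euclidean) UNIV) C"
      unfolding C_def compactin_PiE by (auto simp: D_def compact_Times)
    then show ?thesis by (simp add: euclidean_product_topology)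
  qed
  moreover have "continuous_on C \<phi>"
  proof -
    have co: "continuous_on C (\<lambda>g. fst (g k))" "continuous_on C (\<lambda>g. fst (snd (g k)))"
        "continuous_on C (\<lambda>g. snd (snd (g k)))" for k
      by (intro continuous_on_fst continuous_on_snd
          continuous_on_subset[OF continuous_on_product_coordinates subset_UNIV])+
    have "continuous_on C (\<lambda>g. subnet X (fst (g k), fst (snd (g k))))" for k
      using continuous_on_compose2[OF continuous_on_subnet[of UNIV X] continuous_on_Pair[OF co(1,2)[of k]]]
      by simp
    then show ?thesis
      unfolding \<phi>_def
      by (intro continuous_on_add continuous_on_mult continuous_on_power continuous_on_norm
          continuous_on_diff continuous_on_sum continuous_on_scaleR continuous_on_const co)
  qed
  moreover have zero: "(\<lambda>_. 0) \<in> C" using \<open>R \<ge> 0\<close> by (auto simp: C_def D_def zero_prod_def)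
  ultimately obtain g where g: "g \<in> C" and gmin: "\<And>h. h \<in> C \<Longrightarrow> \<phi> g \<le> \<phi> h"
    using continuous_attains_inf[of C \<phi>] by blast
  have gG: "g \<in> ?G"
  proof clarify
    fix k assume k: "k \<in> {1..K}"
    have "g k \<in> (if k \<in> {1..K} then D else {0})"
      using g unfolding C_def by (rule PiE_mem) simp
    then have "g k \<in> D" unfolding if_P[OF k] .
    then show "norm (fst (g k)) \<le> 1" by (auto simp: D_def)
  qed
  have least: "\<phi> g \<le> \<phi> h" if h: "h \<in> ?G" for h
  proof (cases "\<forall>k\<in>{1..K}. h k \<in> D")
    case True
    define h' where "h' k = (if k \<in> {1..K} then h k else 0)" for k
    have "h' \<in> C" using True by (auto simp: C_def h'_def)
    moreover have "\<phi> h' = \<phi> h" unfolding \<phi>_def h'_def by (simp cong: sum.cong_simp)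
    ultimately show ?thesis using gmin[of h'] by simp
  next
    case False
    then obtain k where k: "k \<in> {1..K}" "h k \<notin> D" by auto
    have "norm (fst (h k)) \<le> 1" using h k by auto
    then have "R < norm (fst (snd (h k))) \<or> R < \<bar>snd (snd (h k))\<bar>"
      using k by (auto simp: D_def mem_Times_iff)
    then have "R\<^sup>2 \<le> (norm (fst (snd (h k))))\<^sup>2 \<or> R\<^sup>2 \<le> (snd (snd (h k)))\<^sup>2"
      using \<open>R \<ge> 0\<close> by (metis less_imp_le power2_abs power_mono)
    then have "R\<^sup>2 \<le> (norm (fst (snd (h k))))\<^sup>2 + (snd (snd (h k)))\<^sup>2"
      by (smt (verit) zero_le_power2)
    also have "\<dots> \<le> (\<Sum>k=1..K. (norm (fst (snd (h k))))\<^sup>2 + (snd (snd (h k)))\<^sup>2)"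
      using k by (intro member_le_sum) auto
    finally have "\<beta>/2 * R\<^sup>2 \<le> \<phi> h" using \<beta> unfolding \<phi>_def
      by (smt (verit) half_gt_zero mult_left_mono zero_le_power2 zero_le_mult_iff)
    moreover have "\<beta>/2 * R\<^sup>2 = 1/2 * (norm y)\<^sup>2" using \<beta> by (simp add: R_def power_divide)
    moreover have "\<phi> g \<le> \<phi> (\<lambda>_. 0)" using zero by (rule gmin)
    moreover have "\<phi> (\<lambda>_. 0) = 1/2 * (norm y)\<^sup>2" by (simp add: \<phi>_def)
    ultimately show ?thesis by linarith
  qed
  have "P_star TYPE('m) X y \<beta> K = \<phi> g"
    unfolding P_star_def vals using gG least by (intro cInf_eq_minimum) auto
  then show ?thesis using gG by (auto simp: vals)
qed

lemma primal_ge_dual: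
  fixes X :: "real^'d^'n" and y :: "real^'n"
  assumes \<beta>: "0 < \<beta>"
    and v: "\<And>\<theta>. \<theta> \<in> (Theta_p :: ((real^'m^'d) \<times> (real^'m)) set) \<Longrightarrow> \<bar>v \<bullet> subnet X \<theta>\<bar> \<le> \<beta>"
    and p: "p \<in> primal_values TYPE('m::finite) X y \<beta> K"
  shows "- 1/2 * (norm (v - y))\<^sup>2 + 1/2 * (norm y)\<^sup>2 \<le> p"
proof -
  obtain W1 :: "nat \<Rightarrow> real^'m^'d" and w2 w3 where
    p_eq: "p = 1/2 * (norm ((\<Sum>k=1..K. w3 k *\<^sub>R subnet X (W1 k, w2 k)) - y))\<^sup>2
          + \<beta>/2 * (\<Sum>k=1..K. (norm (w2 k))\<^sup>2 + (w3 k)\<^sup>2)" and W: "\<forall>k\<in>{1..K}. norm (W1 k) \<le> 1"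
    using p unfolding primal_values_def subnet_eq by blast
  have "v \<bullet> (\<Sum>k=1..K. w3 k *\<^sub>R subnet X (W1 k, w2 k)) = (\<Sum>k=1..K. w3 k * (v \<bullet> subnet X (W1 k, w2 k)))"
    by (simp add: inner_sum_right)
  also have "\<dots> \<le> (\<Sum>k=1..K. \<beta>/2 * ((norm (w2 k))\<^sup>2 + (w3 k)\<^sup>2))"
  proof (rule sum_mono)
    fix k assume "k \<in> {1..K}"
    then have "\<bar>v \<bullet> subnet X (W1 k, w2 k)\<bar> \<le> \<beta> * norm (w2 k)" using W v by (intro inner_subnet_le) auto
    then have "\<bar>w3 k * (v \<bullet> subnet X (W1 k, w2 k))\<bar> \<le> \<bar>w3 k\<bar> * (\<beta> * norm (w2 k))"
      by (simp add: abs_mult mult_left_mono)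
    also have "\<dots> = \<beta>/2 * (2 * norm (w2 k) * \<bar>w3 k\<bar>)" by simp
    \<comment> \<open>The inequality 2ab <= a^2 + b^2 turns the product of the two layer norms into
      weight decay.\<close>
    also have "\<dots> \<le> \<beta>/2 * ((norm (w2 k))\<^sup>2 + (w3 k)\<^sup>2)"
      using \<beta> sum_squares_bound[of "norm (w2 k)" "\<bar>w3 k\<bar>"] by (intro mult_left_mono) auto
    finally show "w3 k * (v \<bullet> subnet X (W1 k, w2 k)) \<le> \<beta>/2 * ((norm (w2 k))\<^sup>2 + (w3 k)\<^sup>2)" by linarith
  qed
  also have "\<dots> = \<beta>/2 * (\<Sum>k=1..K. (norm (w2 k))\<^sup>2 + (w3 k)\<^sup>2)" by (simp add: sum_distrib_left)
  finally show ?thesis unfolding p_eq by (rule weak_duality)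
qed

text \<open>Homogeneity lets sqrt |c| move into \<open>w2\<close> and the same factor into
  \<open>w3\<close>, the split for which 2ab <= a^2 + b^2 is sharp. The sign must go to
  \<open>w3\<close>, since it does not pass through the ReLU. The bound is not an equality because
  \<open>snd (\<theta> k)\<close> may be shorter than 1.\<close>

lemma primal_le_atoms:
  fixes X :: "real^'d^'n" and y :: "real^'n" and \<theta> :: "nat \<Rightarrow> (real^'m::finite^'d) \<times> (real^'m)"
  assumes \<beta>: "0 < \<beta>" and \<theta>: "\<And>k. \<theta> k \<in> Theta_p"
  obtains p where "p \<in> primal_values TYPE('m) X y \<beta> K"
    "p \<le> 1/2 * (norm ((\<Sum>k=1..K. c k *\<^sub>R subnet X (\<theta> k)) - y))\<^sup>2 + \<beta> * (\<Sum>k=1..K. \<bar>c k\<bar>)"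
proof -
  define W1 where "W1 k = fst (\<theta> k)" for k
  define w2 where "w2 k = sqrt \<bar>c k\<bar> *\<^sub>R snd (\<theta> k)" for k
  define w3 where "w3 k = sgn (c k) * sqrt \<bar>c k\<bar>" for k
  have out: "w3 k *\<^sub>R subnet X (W1 k, w2 k) = c k *\<^sub>R subnet X (\<theta> k)" for k
    by (simp add: W1_def w2_def w3_def subnet_scale mult.assoc sgn_mult_abs)
  have reg: "(norm (w2 k))\<^sup>2 + (w3 k)\<^sup>2 \<le> 2 * \<bar>c k\<bar>" for k
  proof -
    have "norm (snd (\<theta> k)) \<le> 1" using \<theta>[of k] by (auto simp: Theta_p_def)
    then have "\<bar>c k\<bar> * (norm (snd (\<theta> k)))\<^sup>2 \<le> \<bar>c k\<bar>"
      by (simp add: mult_left_le power_le_one)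
    moreover have "(w3 k)\<^sup>2 = \<bar>c k\<bar>"
      by (auto simp: w3_def power_mult_distrib sgn_if)
    ultimately show ?thesis by (simp add: w2_def power_mult_distrib)
  qed
  define p where "p = 1/2 * (norm ((\<Sum>k=1..K. w3 k *\<^sub>R subnet X (W1 k, w2 k)) - y))\<^sup>2
          + \<beta>/2 * (\<Sum>k=1..K. (norm (w2 k))\<^sup>2 + (w3 k)\<^sup>2)"
  have "norm (W1 k) \<le> 1" for k using \<theta>[of k] by (auto simp: Theta_p_def W1_def)
  then have "p \<in> primal_values TYPE('m) X y \<beta> K"
    unfolding primal_values_def p_def subnet_eq by blast
  moreover have "\<beta>/2 * (\<Sum>k=1..K. (norm (w2 k))\<^sup>2 + (w3 k)\<^sup>2) \<le> \<beta>/2 * (\<Sum>k=1..K. 2 * \<bar>c k\<bar>)"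
    using \<beta> by (intro mult_left_mono sum_mono reg) auto
  ultimately show thesis using that[of p] by (simp add: p_def out sum_distrib_left[symmetric])
qed

theorem mainTheorem4:
  fixes X :: "real^'d^'n" and y :: "real^'n" and \<beta> :: real
  assumes "\<beta> > 0"
  shows "(\<forall>K\<ge>1. P_star TYPE('m::finite) X y \<beta> K \<in> primal_values TYPE('m) X y \<beta> K)
       \<and> P_B_star TYPE('m) X y \<beta> \<in> bidual_values TYPE('m) X y \<beta>
       \<and> D_star TYPE('m) X y \<beta> \<in> dual_values TYPE('m) X y \<beta>
       \<and> (\<exists>Kstar::nat. Kstar \<le> CARD('n) + 1 \<and>
            (\<forall>K\<ge>1. K \<ge> Kstar \<longrightarrow>
               P_star TYPE('m) X y \<beta> K = P_B_star TYPE('m) X y \<beta> \<and>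
               P_B_star TYPE('m) X y \<beta> = D_star TYPE('m) X y \<beta>))"
proof -
  let ?T = "Theta_p :: ((real^'m^'d) \<times> (real^'m)) set"
  let ?N = "CARD('n) + 1"
  define d where "d v = - 1/2 * (norm (v - y))\<^sup>2 + 1/2 * (norm y)\<^sup>2" for v
  have dual: "dual_values TYPE('m) X y \<beta> = d ` {v. \<forall>\<theta>\<in>?T. \<bar>v \<bullet> subnet X \<theta>\<bar> \<le> \<beta>}"
    unfolding dual_values_def dual_feasible_iff d_def by blast
  have nonempty: "?T \<noteq> {}" by (auto simp: Theta_p_eq)
  have dim: "DIM(real^'n) = CARD('n)" by simp
  note certificate = dual_certificate[OF compact_Theta_p nonempty continuous_on_subnet[of _ X] assms, of y, unfolded dim]
  obtain v where v: "\<And>\<theta>. \<theta> \<in> ?T \<Longrightarrow> \<bar>v \<bullet> subnet X \<theta>\<bar> \<le> \<beta>"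
    and atoms: "\<And>K. ?N \<le> K \<Longrightarrow> \<exists>(c :: nat \<Rightarrow> real) \<theta>. (\<forall>k. \<theta> k \<in> ?T) \<and>
       1/2 * (norm ((\<Sum>k=1..K. c k *\<^sub>R subnet X (\<theta> k)) - y))\<^sup>2 + \<beta> * (\<Sum>k=1..K. \<bar>c k\<bar>) \<le> d v"
    unfolding d_def using certificate by blast

  \<comment> \<open>Stated for every dual feasible \<open>w\<close>, not only for the certificate
    \<open>v\<close>: it yields both minimality in the bidual problem and maximality of
    \<open>v\<close> in the dual one.\<close>
  have bidual_ge: "d w \<le> b"
    if "\<And>\<theta>. \<theta> \<in> ?T \<Longrightarrow> \<bar>w \<bullet> subnet X \<theta>\<bar> \<le> \<beta>" "b \<in> bidual_values TYPE('m) X y \<beta>" for w b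
  proof -
    obtain \<mu> :: "((real^'m^'d) \<times> (real^'m)) set \<Rightarrow> real" where \<mu>: "signed_radon_measure Theta_p \<mu>"
      and b: "b = 1/2 * (norm (signed_integral (restrict_space borel Theta_p) \<mu> (subnet X) - y))\<^sup>2
        + \<beta> * tv_norm Theta_p \<mu>"
      using \<open>b \<in> _\<close> unfolding bidual_values_def by blast
    show ?thesis
      unfolding b d_def using that(1) assms \<mu>
      by (intro weak_duality inner_signed_integral_le compact_Theta_p continuous_on_subnet) auto
  qed
  \<comment> \<open>A bidual value at most \<open>d v\<close>, realized by at most n + 1 point
    masses.\<close>
  obtain b where b: "b \<in> bidual_values TYPE('m) X y \<beta>" "b \<le> d v"
  proof -
    obtain c :: "nat \<Rightarrow> real" and \<theta> where \<theta>: "\<forall>k. \<theta> k \<in> ?T" and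
      le: "1/2 * (norm ((\<Sum>k=1..?N. c k *\<^sub>R subnet X (\<theta> k)) - y))\<^sup>2 + \<beta> * (\<Sum>k=1..?N. \<bar>c k\<bar>) \<le> d v"
      using atoms[OF order_refl] by blast
    obtain \<mu> where \<mu>: "signed_radon_measure ?T \<mu>" "tv_norm ?T \<mu> \<le> (\<Sum>k=1..?N. \<bar>c k\<bar>)"
      "signed_integral (restrict_space borel ?T) \<mu> (subnet X) = (\<Sum>k=1..?N. c k *\<^sub>R subnet X (\<theta> k))"
      using \<theta> by (auto intro: ex_atomic_measure[OF compact_Theta_p finite_atLeastAtMost _ continuous_on_subnet,
            of \<theta> 1 ?N c X])
    have "\<beta> * tv_norm ?T \<mu> \<le> \<beta> * (\<Sum>k=1..?N. \<bar>c k\<bar>)" using \<mu>(2) assms by simp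
    moreover have "1/2 * (norm (signed_integral (restrict_space borel ?T) \<mu> (subnet X) - y))\<^sup>2
        + \<beta> * tv_norm ?T \<mu> \<in> bidual_values TYPE('m) X y \<beta>"
      unfolding bidual_values_def using \<mu>(1) by blast
    ultimately show thesis using that le unfolding \<mu>(3) by fastforce
  qed
  \<comment> \<open>Any dual feasible \<open>w\<close> satisfies
    \<open>d w \<le> b \<le> d v\<close>, so the bidual value \<open>b\<close> separates the dual
    values from anything larger than \<open>d v\<close>.\<close>
  have D: "D_star TYPE('m) X y \<beta> = d v"
    unfolding D_star_def
  proof (rule cSup_eq_maximum)
    show "d v \<in> dual_values TYPE('m) X y \<beta>" using v by (auto simp: dual)
    show "x \<le> d v" if "x \<in> dual_values TYPE('m) X y \<beta>" for x
      using that bidual_ge b by (fastforce simp: dual)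
  qed
  have "b = d v" using b bidual_ge[OF v b(1)] by simp
  then have PB: "P_B_star TYPE('m) X y \<beta> = d v"
    unfolding P_B_star_def using b bidual_ge[OF v] by (intro cInf_eq_minimum) auto
  have P: "P_star TYPE('m) X y \<beta> K = d v" if K: "?N \<le> K" for K
  proof (rule antisym)
    have ge: "d v \<le> p" if "p \<in> primal_values TYPE('m) X y \<beta> K" for p
      unfolding d_def using primal_ge_dual[OF assms v that] by simp
    then show "d v \<le> P_star TYPE('m) X y \<beta> K" using primal_min[OF assms] by blast
    obtain c :: "nat \<Rightarrow> real" and \<theta> where \<theta>: "\<forall>k. \<theta> k \<in> ?T" and
      le: "1/2 * (norm ((\<Sum>k=1..K. c k *\<^sub>R subnet X (\<theta> k)) - y))\<^sup>2 + \<beta> * (\<Sum>k=1..K. \<bar>c k\<bar>) \<le> d v"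
      using atoms[OF K] by blast
    obtain p where p: "p \<in> primal_values TYPE('m) X y \<beta> K" "p \<le> d v"
    proof (rule primal_le_atoms[OF assms, of \<theta> X y K c])
      show "\<theta> k \<in> ?T" for k using \<theta> by blast
    qed (use le in \<open>blast intro: order_trans\<close>)
    have "bdd_below (primal_values TYPE('m) X y \<beta> K)" using ge by (rule bdd_belowI)
    then have "P_star TYPE('m) X y \<beta> K \<le> p" unfolding P_star_def by (rule cInf_lower[OF p(1)])
    then show "P_star TYPE('m) X y \<beta> K \<le> d v" using p(2) by simp
  qed
  show ?thesis
  proof (intro conjI allI impI)
    show "P_star TYPE('m) X y \<beta> K \<in> primal_values TYPE('m) X y \<beta> K" for K
      using assms by (rule primal_min)
    show "P_B_star TYPE('m) X y \<beta> \<in> bidual_values TYPE('m) X y \<beta>" using b \<open>b = d v\<close> PB by simp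
    show "D_star TYPE('m) X y \<beta> \<in> dual_values TYPE('m) X y \<beta>" using v D by (auto simp: dual)
    show "\<exists>Kstar::nat. Kstar \<le> CARD('n) + 1 \<and> (\<forall>K\<ge>1. K \<ge> Kstar \<longrightarrow>
               P_star TYPE('m) X y \<beta> K = P_B_star TYPE('m) X y \<beta> \<and>
               P_B_star TYPE('m) X y \<beta> = D_star TYPE('m) X y \<beta>)"
      using P PB D by (intro exI[of _ ?N]) auto
  qed
qed

end
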